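(* Let $\mathcal{R}$ be a commutative ring containing $\mathbb{Q}$, let $\phi(x)=\sum_{k\ge0}\phi[k]\frac{x^k}{k!}\in\mathcal{R}[[x]]$, let $F(x_0)\in\mathcal{R}[[x_0]]$ be a formal power series in one variable, and let $n\ge1$. Then $$(\Delta_n^{\phi,q}F)(x_0,\dots,x_n;q_0,\dots,q_{n-1})=\sum_{k=1}^nF^{(k)}(x_0)\,B_{n,k}^{\phi}(x_1,\dots,x_n;q_0,\dots,q_{n-1}).$$
   Context: With $\partial_k=\partial/\partial x_k$ and parameters $q_0,q_1,\dots$, put $\mathcal{D}_m^{\phi,q}=\sum_{k=0}^{m-1}\phi(x_{k+1})\,q_k\,\partial_k$ and $\Delta_n^{\phi,q}=\mathcal{D}_n^{\phi,q}\mathcal{D}_{n-1}^{\phi,q}\cdots\mathcal{D}_1^{\phi,q}$. Consider forests (unordered sets) of exactly $k$ (non-plane) rooted trees on a vertex set $[n]\uplus V$, where $[n]=\{1,\dots,n\}$ is the set of internal vertices and $V$ the set of leaves, such that all roots are internal vertices, the elements of $V$ have no children, and internal labels increase along each path starting at a root (internal vertices may have no children). The height $\mathrm{ht}(v)$ of a vertex is its distance to the root of its tree, and $T^{-1}(v)$ is the set of all children of $v$. $B_{n,k}^\phi(\mathbf{x};\mathbf{q})$ is the exponential generating function (in $x_1,\dots,x_n$) of such forests: for $\mathbf{k}=(k_1,\dots,k_n)$ and any finite set $V$ with a map $\kappa:V\to\{1,\dots,n\}$ satisfying $|\kappa^{-1}(i)|=k_i$, the coefficient of $\frac{x_1^{k_1}\cdots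 x_n^{k_n}}{k_1!\cdots k_n!}$ in $B^\phi_{n,k}$ is $\sum\prod_{v\in[n]}\phi[|T^{-1}(v)|]\,q_{\mathrm{ht}(v)}$, the sum being over all such forests with $k$ trees in which every leaf $v\in V$ has height $\kappa(v)$. $F^{(k)}$ denotes the $k$-th derivative. *)

theory Defs
  imports
    "HOL-Library.Poly_Mapping"
    "HOL-Computational_Algebra.Formal_Power_Series"
begin

subsection \<open>Commutative rings containing the rational numbers\<close>

class comm_ring_rat = comm_ring_1 +
  assumes ex_rat_embedding:
    "\<exists>h :: rat \<Rightarrow> 'a. inj h \<and> h 1 = 1
       \<and> (\<forall>a b. h (a + b) = h a + h b) \<and> (\<forall>a b. h (a * b) = h a * h b)"

text \<open>There is only one ring homomorphism from the rationals, so the choice below is harmless.\<close>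

definition rat_embed :: "rat \<Rightarrow> 'a::comm_ring_rat" where
  "rat_embed = (SOME h. inj h \<and> h 1 = 1
       \<and> (\<forall>a b. h (a + b) = h a + h b) \<and> (\<forall>a b. h (a * b) = h a * h b))"

lemma rat_embed:
  shows inj_rat_embed: "inj (rat_embed :: rat \<Rightarrow> 'a::comm_ring_rat)"
    and rat_embed_1 [simp]: "rat_embed 1 = (1 :: 'a)"
    and rat_embed_add: "rat_embed (a + b) = (rat_embed a + rat_embed b :: 'a)"
    and rat_embed_mult: "rat_embed (a * b) = (rat_embed a * rat_embed b :: 'a)"
  using someI_ex[OF ex_rat_embedding[where 'a = 'a], folded rat_embed_def] by blast+

lemma rat_embed_0 [simp]: "rat_embed 0 = (0 :: 'a::comm_ring_rat)"
  using rat_embed_add[of 0 0, where 'a = 'a] by simp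

lemma rat_embed_of_nat [simp]: "rat_embed (of_nat n) = (of_nat n :: 'a::comm_ring_rat)"
  by (induction n) (simp_all add: rat_embed_add)

instance comm_ring_rat \<subseteq> ring_char_0
proof
  show "inj (of_nat :: nat \<Rightarrow> 'a)"
    by (rule injI)
      (metis inj_rat_embed injD of_nat_eq_iff rat_embed_of_nat)
qed

instance field_char_0 \<subseteq> comm_ring_rat
  by standard (rule exI[of _ of_rat], auto simp: inj_def of_rat_add of_rat_mult)


subsection \<open>Formal power series in the variables \<open>x\<^sub>0, x\<^sub>1, x\<^sub>2, \<dots>\<close>\<close>

text \<open>A monomial is given by its finitely supported exponent function, a power series by its
  coefficient function on monomials. Every ring of power series in \<open>x\<^sub>0, \<dots>, x\<^sub>n\<close> is a subring.\<close>

typedef 'a mfps = "UNIV :: ((nat \<Rightarrow>\<^sub>0 nat) \<Rightarrow> 'a) set"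
  morphisms mfps_nth Abs_mfps ..

lemma mfps_nth_Abs [simp]: "mfps_nth (Abs_mfps f) m = f m"
  by (simp add: Abs_mfps_inverse)

lemma mfps_eqI: "(\<And>m. mfps_nth f m = mfps_nth g m) \<Longrightarrow> f = g"
  by (metis ext mfps_nth_inverse)

lemma finite_splittings: "finite {(a, b). a + b = (m :: nat \<Rightarrow>\<^sub>0 nat)}"
proof -
  let ?F = "{f. \<forall>x. (x \<in> Poly_Mapping.keys m \<longrightarrow> f x \<in> {..Max (Poly_Mapping.lookup m ` Poly_Mapping.keys m)}) \<and> (x \<notin> Poly_Mapping.keys m \<longrightarrow> f x = 0)}"
  have "finite ?F"
    by (rule finite_set_of_finite_funs) auto
  moreover have "Poly_Mapping.lookup ` fst ` {(a, b). a + b = m} \<subseteq> ?F"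
  proof clarsimp
    fix a b x
    assume m: "m = a + b"
    have le: "Poly_Mapping.lookup a x \<le> Poly_Mapping.lookup (a + b) x"
      by (simp add: lookup_add)
    show "(x \<in> Poly_Mapping.keys (a + b) \<longrightarrow> Poly_Mapping.lookup a x \<le> Max (Poly_Mapping.lookup (a + b) ` Poly_Mapping.keys (a + b)))
        \<and> (x \<notin> Poly_Mapping.keys (a + b) \<longrightarrow> Poly_Mapping.lookup a x = 0)"
      using le by (auto simp: in_keys_iff intro!: order.trans[OF le] Max_ge)
  qed
  ultimately have "finite (Poly_Mapping.lookup ` fst ` {(a, b). a + b = m})"
    by (rule rev_finite_subset)
  hence "finite (fst ` {(a, b). a + b = m})"
    by (rule finite_imageD) (simp add: inj_on_def)
  thus ?thesis
    by (rule finite_imageD) (auto simp: inj_on_def)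
qed

instantiation mfps :: (comm_ring_1) comm_ring_1
begin

definition "0 = Abs_mfps (\<lambda>m. 0)"
definition "1 = Abs_mfps (\<lambda>m. if m = 0 then 1 else 0)"
definition "f + g = Abs_mfps (\<lambda>m. mfps_nth f m + mfps_nth g m)"
definition "- f = Abs_mfps (\<lambda>m. - mfps_nth f m)"
definition "f - g = Abs_mfps (\<lambda>m. mfps_nth f m - mfps_nth g m)"
definition "f * g = Abs_mfps (\<lambda>m. \<Sum>(a, b) \<in> {(a, b). a + b = m}. mfps_nth f a * mfps_nth g b)"

instance
proof
  fix f g h :: "'a mfps"
  show "f * g * h = f * (g * h)"
  proof (rule mfps_eqI)
    fix m
    let ?S = "\<lambda>m :: nat \<Rightarrow>\<^sub>0 nat. {(a, b). a + b = m}"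
    have "mfps_nth (f * g * h) m =
        (\<Sum>(p, q) \<in> Sigma (?S m) (\<lambda>p. ?S (fst p)).
           mfps_nth f (fst q) * mfps_nth g (snd q) * mfps_nth h (snd p))"
      by (subst sum.Sigma[symmetric])
        (auto simp: times_mfps_def sum_distrib_right finite_splittings split_beta intro!: sum.cong)
    also have "\<dots> = (\<Sum>(p, q) \<in> Sigma (?S m) (\<lambda>p. ?S (snd p)).
           mfps_nth f (fst p) * (mfps_nth g (fst q) * mfps_nth h (snd q)))"
      by (rule sum.reindex_bij_witness[of _
            "\<lambda>(p, q). ((fst p + fst q, snd q), (fst p, fst q))"
            "\<lambda>(p, q). ((fst q, snd q + snd p), (snd q, snd p))"])
        (auto simp: add.assoc mult.assoc)
    also have "\<dots> = mfps_nth (f * (g * h)) m"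
      by (subst sum.Sigma[symmetric])
        (auto simp: times_mfps_def sum_distrib_left finite_splittings split_beta intro!: sum.cong)
    finally show "mfps_nth (f * g * h) m = mfps_nth (f * (g * h)) m" .
  qed
  show "f * g = g * f"
    by (rule mfps_eqI, simp add: times_mfps_def,
        rule sum.reindex_bij_witness[of _ prod.swap prod.swap]) (auto simp: add.commute mult.commute)
  show "1 * f = f"
  proof (rule mfps_eqI)
    fix m
    have "mfps_nth (1 * f) m = (\<Sum>p \<in> {(a, b). a + b = m}. if p = (0, m) then mfps_nth f m else 0)"
      by (auto simp: times_mfps_def one_mfps_def intro!: sum.cong)
    also have "\<dots> = mfps_nth f m"
      by (subst sum.delta) (auto simp: finite_splittings)
    finally show "mfps_nth (1 * f) m = mfps_nth f m" .
  qed
  show "(f + g) * h = f * h + g * h"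
    by (rule mfps_eqI)
      (simp add: times_mfps_def plus_mfps_def distrib_right sum.distrib split_beta)
  show "(0 :: 'a mfps) \<noteq> 1"
  proof
    assume "(0 :: 'a mfps) = 1"
    hence "mfps_nth (0 :: 'a mfps) 0 = mfps_nth 1 0" by (rule arg_cong)
    thus False by (simp add: zero_mfps_def one_mfps_def)
  qed
qed (auto intro!: mfps_eqI
      simp: plus_mfps_def zero_mfps_def uminus_mfps_def minus_mfps_def algebra_simps)

end

lemma mfps_nth_simps [simp]:
  "mfps_nth 0 m = 0"
  "mfps_nth 1 m = (if m = 0 then 1 else 0)"
  "mfps_nth (f + g) m = mfps_nth f m + mfps_nth g m"
  "mfps_nth (- f) m = - mfps_nth f m"
  "mfps_nth (f - g) m = mfps_nth f m - mfps_nth g m"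
  by (simp_all add: zero_mfps_def one_mfps_def plus_mfps_def uminus_mfps_def minus_mfps_def)

lemma mfps_nth_mult:
  "mfps_nth (f * g) m = (\<Sum>(a, b) \<in> {(a, b). a + b = m}. mfps_nth f a * mfps_nth g b)"
  by (simp add: times_mfps_def)

definition mfps_const :: "'a::comm_ring_1 \<Rightarrow> 'a mfps" where
  "mfps_const c = Abs_mfps (\<lambda>m. if m = 0 then c else 0)"

definition mfps_partial :: "nat \<Rightarrow> 'a::comm_ring_1 mfps \<Rightarrow> 'a mfps" where
  "mfps_partial i f =
     Abs_mfps (\<lambda>m. of_nat (Poly_Mapping.lookup m i + 1) * mfps_nth f (m + Poly_Mapping.single i 1))"

text \<open>\<open>fps_in_var i f\<close> is the univariate power series \<open>f\<close> read as \<open>f(x\<^sub>i)\<close>.\<close>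

definition fps_in_var :: "nat \<Rightarrow> 'a::comm_ring_1 fps \<Rightarrow> 'a mfps" where
  "fps_in_var i f = Abs_mfps (\<lambda>m. if Poly_Mapping.keys m \<subseteq> {i} then fps_nth f (Poly_Mapping.lookup m i) else 0)"


subsection \<open>The differential operators\<close>

definition diff_op :: "'a::comm_ring_1 fps \<Rightarrow> (nat \<Rightarrow> 'a) \<Rightarrow> nat \<Rightarrow> 'a mfps \<Rightarrow> 'a mfps" where
  "diff_op \<phi> q m f =
     (\<Sum>k<m. fps_in_var (k + 1) \<phi> * mfps_const (q k) * mfps_partial k f)"

fun Delta_op :: "'a::comm_ring_1 fps \<Rightarrow> (nat \<Rightarrow> 'a) \<Rightarrow> nat \<Rightarrow> 'a mfps \<Rightarrow> 'a mfps" where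
  "Delta_op \<phi> q 0 f = f"
| "Delta_op \<phi> q (Suc n) f = diff_op \<phi> q (Suc n) (Delta_op \<phi> q n f)"


subsection \<open>Increasing forests with leaves\<close>

text \<open>An unordered forest of non-plane rooted trees on a finite vertex set is encoded by its set of
  edges \<open>(parent, child)\<close>: the relation is acyclic and every vertex has at most one parent. The
  roots are the vertices without a parent, one for each tree. Internal vertices are \<open>Inl i\<close>,
  leaves are \<open>Inr v\<close>.\<close>

definition forest_vertices :: "nat \<Rightarrow> 'v set \<Rightarrow> (nat + 'v) set" where
  "forest_vertices n V = Inl ` {1..n} \<union> Inr ` V"

definition rooted_forest :: "'b set \<Rightarrow> ('b \<times> 'b) set \<Rightarrow> bool" where
  "rooted_forest X E \<longleftrightarrow> E \<subseteq> X \<times> X \<and> acyclic E \<and> single_valued (E\<inverse>)"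

definition forest_roots :: "'b set \<Rightarrow> ('b \<times> 'b) set \<Rightarrow> 'b set" where
  "forest_roots X E = {r \<in> X. r \<notin> Range E}"

definition children :: "('b \<times> 'b) set \<Rightarrow> 'b \<Rightarrow> 'b set" where
  "children E v = E `` {v}"

definition height :: "('b \<times> 'b) set \<Rightarrow> 'b \<Rightarrow> nat" where
  "height E v = (LEAST d. \<exists>r. r \<notin> Range E \<and> (r, v) \<in> E ^^ d)"

definition increasing_forests ::
    "nat \<Rightarrow> nat \<Rightarrow> 'v set \<Rightarrow> ('v \<Rightarrow> nat) \<Rightarrow> ((nat + 'v) \<times> (nat + 'v)) set set" where
  "increasing_forests n k V \<kappa> =
     {E. rooted_forest (forest_vertices n V) E
       \<and> forest_roots (forest_vertices n V) E \<subseteq> range Inl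
       \<and> card (forest_roots (forest_vertices n V) E) = k
       \<and> (\<forall>v\<in>V. children E (Inr v) = {})
       \<and> (\<forall>i j. (Inl i, Inl j) \<in> E\<^sup>+ \<longrightarrow> i < j)
       \<and> (\<forall>v\<in>V. height E (Inr v) = \<kappa> v)}"

text \<open>\<open>egf_nth \<phi> j\<close> is the coefficient of \<open>x\<^sup>j / j!\<close> in \<open>\<phi>\<close>.\<close>

definition egf_nth :: "'a::comm_ring_rat fps \<Rightarrow> nat \<Rightarrow> 'a" where
  "egf_nth \<phi> j = fact j * fps_nth \<phi> j"

definition forest_weight ::
    "'a::comm_ring_rat fps \<Rightarrow> (nat \<Rightarrow> 'a) \<Rightarrow> nat \<Rightarrow> ((nat + 'v) \<times> (nat + 'v)) set \<Rightarrow> 'a" where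
  "forest_weight \<phi> q n E =
     (\<Prod>i\<in>{1..n}. egf_nth \<phi> (card (children E (Inl i))) * q (height E (Inl i)))"

definition forest_sum ::
    "'a::comm_ring_rat fps \<Rightarrow> (nat \<Rightarrow> 'a) \<Rightarrow> nat \<Rightarrow> nat \<Rightarrow> 'v set \<Rightarrow> ('v \<Rightarrow> nat) \<Rightarrow> 'a" where
  "forest_sum \<phi> q n k V \<kappa> = (\<Sum>E \<in> increasing_forests n k V \<kappa>. forest_weight \<phi> q n E)"

text \<open>For the exponents \<open>m\<close> the leaf set with exactly \<open>m\<^sub>i\<close> leaves of prescribed height \<open>i\<close> is
  chosen to consist of the pairs \<open>(i, j)\<close> with \<open>j < m\<^sub>i\<close>; that any other choice gives the same
  coefficient is the lemma \<open>forest_series_nth\<close> below.\<close>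

definition forest_series :: "'a::comm_ring_rat fps \<Rightarrow> (nat \<Rightarrow> 'a) \<Rightarrow> nat \<Rightarrow> nat \<Rightarrow> 'a mfps" where
  "forest_series \<phi> q n k = Abs_mfps (\<lambda>m.
     if Poly_Mapping.keys m \<subseteq> {1..n}
     then rat_embed (1 / (\<Prod>i\<in>{1..n}. fact (Poly_Mapping.lookup m i)))
            * forest_sum \<phi> q n k (SIGMA i:{1..n}. {..<Poly_Mapping.lookup m i}) fst
     else 0)"


subsection \<open>Independence of the choice of the leaf set\<close>

lemma rename_mem_iff:
  assumes "inj_on g X" "E \<subseteq> X \<times> X" "u \<in> X" "v \<in> X"
  shows "(g u, g v) \<in> map_prod g g ` E \<longleftrightarrow> (u, v) \<in> E"
proof
  assume "(g u, g v) \<in> map_prod g g ` E"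
  then obtain a b where ab: "(a, b) \<in> E" "g u = g a" "g v = g b"
    by auto
  hence "u = a" "v = b"
    using assms by (auto dest: inj_onD)
  thus "(u, v) \<in> E" using ab by simp
next
  assume "(u, v) \<in> E"
  hence "map_prod g g (u, v) \<in> map_prod g g ` E" by (rule imageI)
  thus "(g u, g v) \<in> map_prod g g ` E" by simp
qed

lemma rename_relpow_iff:
  assumes "inj_on g X" "E \<subseteq> X \<times> X" "u \<in> X" "v \<in> X"
  shows "(g u, g v) \<in> (map_prod g g ` E) ^^ d \<longleftrightarrow> (u, v) \<in> E ^^ d"
  using assms(4)
proof (induction d arbitrary: v)
  case 0
  thus ?case using assms by (auto dest: inj_onD)
next
  case (Suc d)
  have "(g u, g v) \<in> (map_prod g g ` E) ^^ Suc d \<longleftrightarrow>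
      (\<exists>w\<in>X. (g u, g w) \<in> (map_prod g g ` E) ^^ d \<and> (g w, g v) \<in> map_prod g g ` E)"
    using assms(2) by (auto simp: relcomp_unfold) (blast, force)
  also have "\<dots> \<longleftrightarrow> (\<exists>w\<in>X. (u, w) \<in> E ^^ d \<and> (w, v) \<in> E)"
    using Suc rename_mem_iff[OF assms(1,2)] by auto
  also have "\<dots> \<longleftrightarrow> (u, v) \<in> E ^^ Suc d"
    using assms(2) by (auto simp: relcomp_unfold)
  finally show ?case .
qed

lemma rename_trancl_iff:
  assumes "inj_on g X" "E \<subseteq> X \<times> X" "u \<in> X" "v \<in> X"
  shows "(g u, g v) \<in> (map_prod g g ` E)\<^sup>+ \<longleftrightarrow> (u, v) \<in> E\<^sup>+"
  using rename_relpow_iff[OF assms] by (simp add: trancl_power)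

lemma rename_Range_iff:
  assumes "inj_on g X" "E \<subseteq> X \<times> X" "u \<in> X"
  shows "g u \<in> Range (map_prod g g ` E) \<longleftrightarrow> u \<in> Range E"
proof
  assume "g u \<in> Range (map_prod g g ` E)"
  then obtain a b where ab: "(a, b) \<in> E" "g u = g b"
    by auto
  hence "u = b"
    using assms by (auto dest: inj_onD)
  thus "u \<in> Range E" using ab by auto
next
  assume "u \<in> Range E"
  then obtain a where "(a, u) \<in> E" by auto
  hence "map_prod g g (a, u) \<in> map_prod g g ` E" by (rule imageI)
  thus "g u \<in> Range (map_prod g g ` E)" unfolding map_prod_simp by (rule RangeI)
qed

lemma rename_children:
  assumes "inj_on g X" "E \<subseteq> X \<times> X" "u \<in> X"
  shows "children (map_prod g g ` E) (g u) = g ` children E u"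
proof (intro equalityI subsetI)
  fix y assume "y \<in> children (map_prod g g ` E) (g u)"
  then obtain a b where ab: "(a, b) \<in> E" "g u = g a" "y = g b"
    by (auto simp: children_def)
  hence "u = a"
    using assms by (auto dest: inj_onD)
  thus "y \<in> g ` children E u" using ab by (auto simp: children_def)
next
  fix y assume "y \<in> g ` children E u"
  then obtain b where "(u, b) \<in> E" "y = g b"
    by (auto simp: children_def)
  thus "y \<in> children (map_prod g g ` E) (g u)" by (force simp: children_def)
qed

lemma rename_height:
  assumes "inj_on g X" "E \<subseteq> X \<times> X" "u \<in> X"
  shows "height (map_prod g g ` E) (g u) = height E u"
proof -
  let ?R = "map_prod g g ` E"
  have "(\<exists>r. r \<notin> Range ?R \<and> (r, g u) \<in> ?R ^^ d) \<longleftrightarrow> (\<exists>r. r \<notin> Range E \<and> (r, u) \<in> E ^^ d)" for d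
  proof -
    have 1: "r \<in> g ` X" if r: "(r, g u) \<in> ?R ^^ d" for r
    proof (cases d)
      case 0
      thus ?thesis using r assms by auto
    next
      case (Suc d')
      then obtain y where "(r, y) \<in> ?R"
        using relpow_Suc_D2[OF r[unfolded Suc]] by blast
      thus ?thesis using assms by auto
    qed
    have 2: "r \<in> X" if r: "(r, u) \<in> E ^^ d" for r
    proof (cases d)
      case 0
      thus ?thesis using r assms by auto
    next
      case (Suc d')
      then obtain y where "(r, y) \<in> E"
        using relpow_Suc_D2[OF r[unfolded Suc]] by blast
      thus ?thesis using assms by auto
    qed
    have "(\<exists>r. r \<notin> Range ?R \<and> (r, g u) \<in> ?R ^^ d) \<longleftrightarrow>
        (\<exists>r\<in>X. g r \<notin> Range ?R \<and> (g r, g u) \<in> ?R ^^ d)"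
      using 1 by blast
    also have "\<dots> \<longleftrightarrow> (\<exists>r\<in>X. r \<notin> Range E \<and> (r, u) \<in> E ^^ d)"
      using rename_Range_iff[OF assms(1,2)] rename_relpow_iff[OF assms(1,2) _ assms(3)] by auto
    also have "\<dots> \<longleftrightarrow> (\<exists>r. r \<notin> Range E \<and> (r, u) \<in> E ^^ d)"
      using 2 by blast
    finally show ?thesis .
  qed
  thus ?thesis by (simp add: height_def)
qed

lemma rename_increasing_forest:
  fixes \<beta> :: "'v \<Rightarrow> 'w" and \<phi> :: "'a::comm_ring_rat fps"
  defines "g \<equiv> map_sum id \<beta> :: nat + 'v \<Rightarrow> nat + 'w"
  assumes \<beta>: "bij_betw \<beta> V W" and \<kappa>: "\<And>v. v \<in> V \<Longrightarrow> \<kappa>' (\<beta> v) = \<kappa> v"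
    and E: "E \<in> increasing_forests n k V \<kappa>"
  shows "map_prod g g ` E \<in> increasing_forests n k W \<kappa>'"
    and "forest_weight \<phi> q n (map_prod g g ` E) = forest_weight \<phi> q n E"
proof -
  let ?X = "forest_vertices n V" and ?R = "map_prod g g ` E"
  have gX: "g ` ?X = forest_vertices n W"
    using \<beta> by (auto simp: g_def forest_vertices_def image_Un image_image bij_betw_def)
  have inj: "inj_on g ?X"
  proof (rule inj_onI)
    fix x y assume "x \<in> ?X" "y \<in> ?X" "g x = g y"
    moreover have "inj_on \<beta> V" using \<beta> by (simp add: bij_betw_def)
    ultimately show "x = y"
      by (cases x; cases y) (auto simp: g_def forest_vertices_def dest: inj_onD)
  qed
  have EX: "E \<subseteq> ?X \<times> ?X" and acyc: "acyclic E" and sv: "single_valued (E\<inverse>)"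
    using E by (auto simp: increasing_forests_def rooted_forest_def)
  have RX: "?R \<subseteq> g ` ?X \<times> g ` ?X"
    using EX by auto
  have [simp]: "g (Inl i) = Inl i" "g (Inr v) = Inr (\<beta> v)" for i v
    by (simp_all add: g_def)
  have W: "W = \<beta> ` V"
    using \<beta> by (auto simp: bij_betw_def)
  have Inr_X: "Inr v \<in> ?X" if "v \<in> V" for v
    using that by (auto simp: forest_vertices_def)
  have Inl_X: "Inl i \<in> ?X" if "i \<in> {1..n}" for i
    using that by (auto simp: forest_vertices_def)
  have "acyclic ?R"
    unfolding acyclic_def
  proof (intro allI notI)
    fix x assume x: "(x, x) \<in> ?R\<^sup>+"
    hence "x \<in> g ` ?X"
      using trancl_subset_Sigma[OF RX] by auto
    then obtain u where "u \<in> ?X" "x = g u" by auto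
    thus False
      using x rename_trancl_iff[OF inj EX, of u u] acyc by (auto simp: acyclic_def)
  qed
  moreover have "single_valued (?R\<inverse>)"
  proof (rule single_valuedI)
    fix x y z assume "(x, y) \<in> ?R\<inverse>" "(x, z) \<in> ?R\<inverse>"
    then obtain a b c d where *: "(a, b) \<in> E" "(c, d) \<in> E" "x = g b" "x = g d" "y = g a" "z = g c"
      by auto
    hence "b = d"
      using inj EX by (auto dest: inj_onD)
    hence "a = c"
      using sv * by (auto dest: single_valuedD)
    thus "y = z" using * by simp
  qed
  ultimately have forest: "rooted_forest (forest_vertices n W) ?R"
    using RX gX by (simp add: rooted_forest_def)
  have roots: "forest_roots (forest_vertices n W) ?R = g ` forest_roots ?X E"
  proof (intro equalityI subsetI)
    fix x assume "x \<in> forest_roots (forest_vertices n W) ?R"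
    then obtain u where u: "u \<in> ?X" "x = g u" "g u \<notin> Range ?R"
      unfolding forest_roots_def gX[symmetric] by (elim CollectE conjE imageE) simp
    thus "x \<in> g ` forest_roots ?X E"
      unfolding rename_Range_iff[OF inj EX u(1)] by (simp add: forest_roots_def)
  next
    fix x assume "x \<in> g ` forest_roots ?X E"
    then obtain u where u: "u \<in> ?X" "x = g u" "u \<notin> Range E"
      by (auto simp: forest_roots_def)
    show "x \<in> forest_roots (forest_vertices n W) ?R"
      using u rename_Range_iff[OF inj EX u(1)]
      unfolding forest_roots_def gX[symmetric] by (simp del: Range_iff)
  qed
  have "inj_on g (forest_roots ?X E)"
    using inj by (rule inj_on_subset) (auto simp: forest_roots_def)
  hence card_roots: "card (forest_roots (forest_vertices n W) ?R) = k"
    using E roots by (simp add: card_image increasing_forests_def)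
  have "forest_roots ?X E \<subseteq> range Inl"
    using E by (simp add: increasing_forests_def)
  hence roots_Inl: "forest_roots (forest_vertices n W) ?R \<subseteq> range Inl"
    unfolding roots by fastforce
  have incr: "i < j" if "(Inl i, Inl j) \<in> ?R\<^sup>+" for i j
  proof -
    have "Inl i \<in> g ` ?X" "Inl j \<in> g ` ?X"
      using that RX trancl_subset_Sigma[OF RX] by auto
    hence "Inl i \<in> ?X" "Inl j \<in> ?X"
      unfolding gX by (auto simp: forest_vertices_def)
    hence "(Inl i, Inl j) \<in> E\<^sup>+"
      using that rename_trancl_iff[OF inj EX, of "Inl i" "Inl j"] by simp
    thus ?thesis using E by (simp add: increasing_forests_def)
  qed
  have leaf: "children ?R (Inr w) = {} \<and> height ?R (Inr w) = \<kappa>' w" if w: "w \<in> W" for w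
  proof -
    obtain v where v: "v \<in> V" "w = \<beta> v" using w unfolding W by blast
    show ?thesis
      using rename_children[OF inj EX Inr_X[OF v(1)]] rename_height[OF inj EX Inr_X[OF v(1)]]
        E v \<kappa> by (simp add: increasing_forests_def)
  qed
  show "?R \<in> increasing_forests n k W \<kappa>'"
    using forest roots_Inl card_roots incr leaf by (simp add: increasing_forests_def)
  have "card (children ?R (Inl i)) = card (children E (Inl i))
      \<and> height ?R (Inl i) = height E (Inl i)" if "i \<in> {1..n}" for i
  proof -
    have "inj_on g (children E (Inl i))"
      using inj by (rule inj_on_subset) (use EX in \<open>auto simp: children_def\<close>)
    thus ?thesis
      using rename_children[OF inj EX Inl_X[OF that]] rename_height[OF inj EX Inl_X[OF that]]
      by (simp add: card_image)
  qed
  thus "forest_weight \<phi> q n ?R = forest_weight \<phi> q n E"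
    unfolding forest_weight_def by (intro prod.cong) auto
qed

lemma forest_sum_rename:
  assumes \<beta>: "bij_betw \<beta> V W" and \<kappa>: "\<And>v. v \<in> V \<Longrightarrow> \<kappa>' (\<beta> v) = \<kappa> v"
  shows "forest_sum \<phi> q n k V \<kappa> = forest_sum \<phi> q n k W \<kappa>'"
proof -
  define \<gamma> where "\<gamma> = inv_into V \<beta>"
  have \<gamma>: "bij_betw \<gamma> W V"
    unfolding \<gamma>_def using \<beta> by (rule bij_betw_inv_into)
  have \<gamma>\<beta>: "\<gamma> (\<beta> v) = v" if "v \<in> V" for v
    unfolding \<gamma>_def using \<beta> that by (auto simp: bij_betw_def)
  have \<beta>\<gamma>: "\<beta> (\<gamma> w) = w" if "w \<in> W" for w
    unfolding \<gamma>_def using \<beta> that by (auto simp: bij_betw_def f_inv_into_f)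
  have \<kappa>': "\<kappa> (\<gamma> w) = \<kappa>' w" if "w \<in> W" for w
    using \<kappa>[of "\<gamma> w"] \<gamma> \<beta>\<gamma> that by (auto simp: bij_betw_def)
  let ?g = "map_sum id \<beta> :: nat + _ \<Rightarrow> _" and ?h = "map_sum id \<gamma> :: nat + _ \<Rightarrow> _"
  have image_id: "map_prod h h ` map_prod g g ` E = E"
    if "E \<subseteq> X \<times> X" "\<And>x. x \<in> X \<Longrightarrow> h (g x) = x" for g :: "'x \<Rightarrow> 'y" and h E X
  proof -
    have "map_prod h h (map_prod g g p) = p" if "p \<in> E" for p
      using that \<open>E \<subseteq> X \<times> X\<close> \<open>\<And>x. x \<in> X \<Longrightarrow> h (g x) = x\<close> by (cases p) auto
    thus ?thesis by (simp add: image_image)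
  qed
  show ?thesis
    unfolding forest_sum_def
  proof (rule sum.reindex_bij_witness[of _ "\<lambda>E. map_prod ?h ?h ` E" "\<lambda>E. map_prod ?g ?g ` E"])
    fix E assume E: "E \<in> increasing_forests n k V \<kappa>"
    show "map_prod ?h ?h ` map_prod ?g ?g ` E = E"
      using E by (intro image_id[of _ "forest_vertices n V"])
        (auto simp: increasing_forests_def rooted_forest_def forest_vertices_def \<gamma>\<beta>)
    show "map_prod ?g ?g ` E \<in> increasing_forests n k W \<kappa>'"
      using \<beta> \<kappa> E by (rule rename_increasing_forest(1))
    show "forest_weight \<phi> q n (map_prod ?g ?g ` E) = forest_weight \<phi> q n E"
      using \<beta> \<kappa> E by (rule rename_increasing_forest(2))
  next
    fix E assume E: "E \<in> increasing_forests n k W \<kappa>'"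
    show "map_prod ?g ?g ` map_prod ?h ?h ` E = E"
      using E by (intro image_id[of _ "forest_vertices n W"])
        (auto simp: increasing_forests_def rooted_forest_def forest_vertices_def \<beta>\<gamma>)
    show "map_prod ?h ?h ` E \<in> increasing_forests n k V \<kappa>"
      using \<gamma> \<kappa>' E by (rule rename_increasing_forest(1))
  qed
qed

lemma forest_series_nth:
  fixes \<phi> :: "'a::comm_ring_rat fps"
  assumes "finite V" "\<kappa> ` V \<subseteq> {1..n}" "Poly_Mapping.keys m \<subseteq> {1..n}"
    and card: "\<And>i. i \<in> {1..n} \<Longrightarrow> card {v \<in> V. \<kappa> v = i} = Poly_Mapping.lookup m i"
  shows "(\<Prod>i\<in>{1..n}. fact (Poly_Mapping.lookup m i)) * mfps_nth (forest_series \<phi> q n k) m =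
           forest_sum \<phi> q n k V \<kappa>"
proof -
  let ?W = "SIGMA i:{1..n}. {..<Poly_Mapping.lookup m i}"
  have "\<exists>f. bij_betw f {v \<in> V. \<kappa> v = i} {..<Poly_Mapping.lookup m i}" if "i \<in> {1..n}" for i
    using assms(1) card[OF that] by (intro finite_same_card_bij) auto
  then obtain f where f: "\<And>i. i \<in> {1..n} \<Longrightarrow>
      bij_betw (f i) {v \<in> V. \<kappa> v = i} {..<Poly_Mapping.lookup m i}"
    by metis
  have "bij_betw (\<lambda>v. (\<kappa> v, f (\<kappa> v) v)) V ?W"
    unfolding bij_betw_def
  proof (intro conjI equalityI subsetI)
    show "inj_on (\<lambda>v. (\<kappa> v, f (\<kappa> v) v)) V"
    proof (rule inj_onI)
      fix u v assume uv: "u \<in> V" "v \<in> V" "(\<kappa> u, f (\<kappa> u) u) = (\<kappa> v, f (\<kappa> v) v)"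
      have "inj_on (f (\<kappa> v)) {w \<in> V. \<kappa> w = \<kappa> v}"
        using f[of "\<kappa> v"] assms(2) uv by (auto simp: bij_betw_def)
      thus "u = v" using uv by (auto dest: inj_onD)
    qed
    fix p assume "p \<in> (\<lambda>v. (\<kappa> v, f (\<kappa> v) v)) ` V"
    then obtain v where v: "v \<in> V" "p = (\<kappa> v, f (\<kappa> v) v)" by auto
    hence "\<kappa> v \<in> {1..n}" using assms(2) by auto
    thus "p \<in> ?W"
      using f[of "\<kappa> v"] v by (auto simp: bij_betw_def)
  next
    fix p assume "p \<in> ?W"
    then obtain i j where p: "p = (i, j)" "i \<in> {1..n}" "j < Poly_Mapping.lookup m i" by auto
    hence "j \<in> f i ` {v \<in> V. \<kappa> v = i}"
      using f[of i] by (simp add: bij_betw_def)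
    thus "p \<in> (\<lambda>v. (\<kappa> v, f (\<kappa> v) v)) ` V"
      using p by auto
  qed
  hence eq: "forest_sum \<phi> q n k V \<kappa> = forest_sum \<phi> q n k ?W fst"
    by (rule forest_sum_rename) simp
  have "(\<Prod>i\<in>{1..n}. fact (Poly_Mapping.lookup m i)) = 
      (rat_embed (\<Prod>i\<in>{1..n}. fact (Poly_Mapping.lookup m i)) :: 'a)"
    using rat_embed_of_nat[of "\<Prod>i\<in>{1..n}. fact (Poly_Mapping.lookup m i)", where 'a = 'a] by simp
  hence "(\<Prod>i\<in>{1..n}. fact (Poly_Mapping.lookup m i)) *
      rat_embed (1 / (\<Prod>i\<in>{1..n}. fact (Poly_Mapping.lookup m i))) = (1 :: 'a)"
    by (simp flip: rat_embed_mult)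
  thus ?thesis
    using assms(3) by (simp add: forest_series_def eq flip: mult.assoc)
qed

end

theory Submission
  imports Defs "HOL-Library.FuncSet"
begin

text \<open>Joining the roots of a forest to a new vertex \<open>0\<close> gives an increasing tree, and \<open>F\<close> plays for
  the vertex \<open>0\<close> the role of \<open>\<phi>\<close> for the others. By the Leibniz rule, applying the \<open>n\<close>-th operator to
  the product over the vertices \<open>j\<close> of the \<open>c\<^sub>j\<close>-th derivatives of these series, taken at \<open>x\<close>
  indexed by the depth of \<open>j\<close> (with \<open>c\<^sub>j\<close> the number of children of \<open>j\<close>), attaches the vertex
  \<open>n\<close> in all possible ways. Hence \<open>\<Delta>\<^sub>n F\<close> is the sum of these products over all increasing trees on
  \<open>{0..n}\<close> without leaves. By the same rule, extracting a coefficient of such a product attaches the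
  leaves.\<close>

section \<open>Partial derivatives of multivariate power series\<close>

lemma poly_mapping_add_eq_0_iff:
  fixes a b :: "'b \<Rightarrow>\<^sub>0 nat"
  shows "a + b = 0 \<longleftrightarrow> a = 0 \<and> b = 0"
  by (auto simp: poly_mapping_eq_iff fun_eq_iff lookup_add)

lemma mfps_nth_mult_0: "mfps_nth (f * g) 0 = mfps_nth f 0 * mfps_nth g 0"
proof -
  have "{(a, b). a + b = (0 :: nat \<Rightarrow>\<^sub>0 nat)} = {(0, 0)}"
    by (auto simp: poly_mapping_add_eq_0_iff)
  thus ?thesis by (simp add: mfps_nth_mult)
qed

lemma mfps_nth_prod_0: "mfps_nth (\<Prod>j\<in>A. f j) 0 = (\<Prod>j\<in>A. mfps_nth (f j) 0)"
  by (induction A rule: infinite_finite_induct) (simp_all add: mfps_nth_mult_0)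

lemma mfps_nth_sum: "mfps_nth (\<Sum>j\<in>A. f j) m = (\<Sum>j\<in>A. mfps_nth (f j) m)"
  by (induction A rule: infinite_finite_induct) simp_all

lemma mfps_nth_const_mult: "mfps_nth (mfps_const c * f) m = c * mfps_nth f m"
proof -
  have "mfps_nth (mfps_const c * f) m =
      (\<Sum>p \<in> {(a, b). a + b = m}. if p = (0, m) then c * mfps_nth f m else 0)"
    by (auto simp: mfps_nth_mult mfps_const_def intro!: sum.cong)
  also have "\<dots> = c * mfps_nth f m"
    by (subst sum.delta) (auto simp: finite_splittings)
  finally show ?thesis .
qed

lemma mfps_const_mult: "mfps_const (c * c') = mfps_const c * mfps_const c'"
  by (rule mfps_eqI) (simp add: mfps_nth_const_mult, simp add: mfps_const_def)

lemma mfps_nth_partial: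
  "mfps_nth (mfps_partial i f) m =
     of_nat (Poly_Mapping.lookup m i + 1) * mfps_nth f (m + Poly_Mapping.single i 1)"
  by (simp add: mfps_partial_def)

section \<open>Linearity and the Leibniz rule\<close>

lemma mfps_partial_sum: "mfps_partial i (\<Sum>j\<in>A. f j) = (\<Sum>j\<in>A. mfps_partial i (f j))"
  by (rule mfps_eqI) (simp add: mfps_nth_partial mfps_nth_sum sum_distrib_left)

lemma mfps_partial_const_mult: "mfps_partial i (mfps_const c * f) = mfps_const c * mfps_partial i f"
  by (rule mfps_eqI) (simp add: mfps_nth_partial mfps_nth_const_mult mult.left_commute)

text \<open>At \<open>m\<close>, all terms are sums over the splittings \<open>a + b\<close> of
  \<open>m\<close> plus the \<open>i\<close>-th unit vector. The two products on the right weight a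
  splitting by the exponents of variable \<open>i\<close> in \<open>a\<close> and in
  \<open>b\<close>, which add up to the constant factor on the left.\<close>

lemma mfps_partial_mult:
  "mfps_partial i (f * g) = mfps_partial i f * g + f * mfps_partial i g"
proof (rule mfps_eqI)
  fix m
  let ?e = "Poly_Mapping.single i 1 :: nat \<Rightarrow>\<^sub>0 nat"
  let ?S = "\<lambda>m :: nat \<Rightarrow>\<^sub>0 nat. {(a, b). a + b = m}"
  have half: "mfps_nth (mfps_partial i f * g) m =
      (\<Sum>(a, b)\<in>?S (m + ?e). of_nat (Poly_Mapping.lookup a i) * (mfps_nth f a * mfps_nth g b))"
    for f g :: "'a mfps"
  proof -
    let ?h = "\<lambda>(a, b). (a + ?e, b)"
    have "mfps_nth (mfps_partial i f * g) m = (\<Sum>(a, b)\<in>?h ` ?S m.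
        of_nat (Poly_Mapping.lookup a i) * (mfps_nth f a * mfps_nth g b))"
      by (subst sum.reindex)
        (auto simp: inj_on_def mfps_nth_mult mfps_nth_partial lookup_add split_beta mult.assoc
          intro!: sum.cong)
    also have "\<dots> = (\<Sum>(a, b)\<in>?S (m + ?e).
        of_nat (Poly_Mapping.lookup a i) * (mfps_nth f a * mfps_nth g b))"
    \<comment> \<open>The shift reaches exactly the splittings in which \<open>a\<close> has a
      positive exponent at \<open>i\<close>; all others carry weight 0.\<close>
    proof (rule sum.mono_neutral_left)
      show "?h ` ?S m \<subseteq> ?S (m + ?e)"
        by (auto simp: ac_simps)
      show "\<forall>p\<in>?S (m + ?e) - ?h ` ?S m.
          (case p of (a, b) \<Rightarrow> of_nat (Poly_Mapping.lookup a i) * (mfps_nth f a * mfps_nth g b)) = 0"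
      proof clarify
        fix a b assume ab: "a + b = m + ?e" and notin: "(a, b) \<notin> ?h ` ?S m"
        have "Poly_Mapping.lookup a i = 0"
        proof (rule ccontr)
          assume pos: "Poly_Mapping.lookup a i \<noteq> 0"
          define c where "c = a - ?e"
          have a: "a = c + ?e"
            using pos by (intro poly_mapping_eqI)
              (auto simp: c_def lookup_add minus_poly_mapping.rep_eq lookup_single when_def)
          have "c + b + ?e = m + ?e"
            using ab by (simp add: a ac_simps)
          hence "c + b = m" by simp
          thus False using notin a by force
        qed
        thus "of_nat (Poly_Mapping.lookup a i) * (mfps_nth f a * mfps_nth g b) = 0" by simp
      qed
    qed (rule finite_splittings)
    finally show ?thesis .
  qed
  have "mfps_nth (f * mfps_partial i g) m = mfps_nth (mfps_partial i g * f) m"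
    by (simp add: mult.commute)
  also have "\<dots> = (\<Sum>(a, b)\<in>?S (m + ?e).
      of_nat (Poly_Mapping.lookup b i) * (mfps_nth f a * mfps_nth g b))"
    unfolding half
    by (rule sum.reindex_bij_witness[of _ prod.swap prod.swap]) (auto simp: ac_simps)
  finally have "mfps_nth (mfps_partial i f * g + f * mfps_partial i g) m =
      (\<Sum>(a, b)\<in>?S (m + ?e). of_nat (Poly_Mapping.lookup (a + b) i) * (mfps_nth f a * mfps_nth g b))"
    by (simp add: half lookup_add split_beta distrib_right flip: sum.distrib)
  also have "\<dots> =
      (\<Sum>(a, b)\<in>?S (m + ?e). of_nat (Poly_Mapping.lookup (m + ?e) i) * (mfps_nth f a * mfps_nth g b))"
    by (intro sum.cong) auto
  also have "\<dots> = mfps_nth (mfps_partial i (f * g)) m"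
    by (simp add: mfps_nth_partial mfps_nth_mult sum_distrib_left lookup_add split_beta)
  finally show "mfps_nth (mfps_partial i (f * g)) m =
      mfps_nth (mfps_partial i f * g + f * mfps_partial i g) m" ..
qed

lemma mfps_partial_1 [simp]: "mfps_partial i (1 :: 'a::comm_ring_1 mfps) = 0"
proof (rule mfps_eqI)
  fix m :: "nat \<Rightarrow>\<^sub>0 nat"
  have "Poly_Mapping.lookup (m + Poly_Mapping.single i 1) i \<noteq> 0"
    by (simp add: lookup_add)
  hence "m + Poly_Mapping.single i 1 \<noteq> 0" by force
  thus "mfps_nth (mfps_partial i 1) m = mfps_nth (0 :: 'a mfps) m"
    by (simp add: mfps_nth_partial)
qed

lemma mfps_partial_prod:
  assumes "finite A"
  shows "mfps_partial i (\<Prod>j\<in>A. f j) = (\<Sum>j\<in>A. mfps_partial i (f j) * (\<Prod>l\<in>A - {j}. f l))"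
  using assms
proof (induction A)
  case (insert j A)
  have "(\<Prod>l\<in>insert j A - {k}. f l) = f j * (\<Prod>l\<in>A - {k}. f l)" if "k \<in> A" for k
  proof -
    have "insert j A - {k} = insert j (A - {k})" using that insert.hyps by auto
    thus ?thesis using insert.hyps by simp
  qed
  moreover have "insert j A - {j} = A" using insert.hyps by auto
  ultimately show ?case
    using insert by (simp add: mfps_partial_mult sum_distrib_left mult.left_commute)
qed simp

lemma mfps_partial_in_var:
  "mfps_partial i (fps_in_var j f) = (if j = i then fps_in_var j (fps_deriv f) else 0)"
proof (rule mfps_eqI)
  fix m :: "nat \<Rightarrow>\<^sub>0 nat"
  have "Poly_Mapping.keys (m + Poly_Mapping.single i 1) = insert i (Poly_Mapping.keys m)"
    by (auto simp: in_keys_iff lookup_add lookup_single when_def split: if_splits)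
  thus "mfps_nth (mfps_partial i (fps_in_var j f)) m =
      mfps_nth (if j = i then fps_in_var j (fps_deriv f) else 0) m"
    by (auto simp: mfps_nth_partial fps_in_var_def lookup_add)
qed

text \<open>The ring may have zero divisors, but positive integers are units in it since it contains
  the rationals.\<close>

lemma of_nat_mult_eq_0_rat:
  fixes x :: "'a::comm_ring_rat"
  assumes "of_nat k * x = 0" "k \<noteq> 0"
  shows "x = 0"
proof -
  have "rat_embed (1 / of_nat k) * of_nat k = (1 :: 'a)"
    using assms(2) rat_embed_mult[of "1 / of_nat k" "of_nat k", where 'a = 'a] by simp
  hence "x = rat_embed (1 / of_nat k) * (of_nat k * x)"
    by (simp flip: mult.assoc)
  thus ?thesis using assms(1) by simp
qed

text \<open>Lowering the exponent at \<open>i\<close> by one gives a monomial at which the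
  coefficient of the derivative is a positive integer times the coefficient of \<open>f\<close> at
  \<open>m\<close>.\<close>

lemma mfps_nth_eq_0_if_partial_eq_0:
  fixes f :: "'a::comm_ring_rat mfps"
  assumes "mfps_partial i f = 0" "i \<in> Poly_Mapping.keys m"
  shows "mfps_nth f m = 0"
proof -
  define c where "c = m - Poly_Mapping.single i 1"
  have m: "m = c + Poly_Mapping.single i 1"
    using assms(2) by (intro poly_mapping_eqI)
      (auto simp: c_def in_keys_iff lookup_add minus_poly_mapping.rep_eq lookup_single when_def)
  have "of_nat (Poly_Mapping.lookup c i + 1) * mfps_nth f m = 0"
    using mfps_nth_partial[of i f c] assms(1) m by simp
  thus ?thesis by (rule of_nat_mult_eq_0_rat) simp
qed


section \<open>Products of derivatives of univariate series\<close>

text \<open>For a tree on \<open>A\<close>, \<open>d\<close> will be the depth and \<open>a\<close>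
  the number of children. The series form a family so that vertex 0 can carry \<open>F\<close> and
  the others \<phi>.\<close>

definition deriv_prod ::
    "'b set \<Rightarrow> ('b \<Rightarrow> nat) \<Rightarrow> ('b \<Rightarrow> nat) \<Rightarrow> ('b \<Rightarrow> 'a::comm_ring_1 fps) \<Rightarrow> 'a mfps" where
  "deriv_prod A d a f = (\<Prod>j\<in>A. fps_in_var (d j) ((fps_deriv ^^ a j) (f j)))"

lemma deriv_prod_cong:
  assumes "A = B" "\<And>j. j \<in> B \<Longrightarrow> d j = d' j" "\<And>j. j \<in> B \<Longrightarrow> a j = a' j" "\<And>j. j \<in> B \<Longrightarrow> f j = f' j"
  shows "deriv_prod A d a f = deriv_prod B d' a' f'"
  unfolding deriv_prod_def using assms by (intro prod.cong) auto

text \<open>Only factors in variable \<open>i\<close> survive the Leibniz rule, and the derivative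
  of such a factor has order one higher. So the shape is preserved, and each summand gives one
  vertex at depth \<open>i\<close> a further child.\<close>

lemma mfps_partial_deriv_prod:
  assumes "finite A"
  shows "mfps_partial i (deriv_prod A d a f) =
    (\<Sum>j | j \<in> A \<and> d j = i. deriv_prod A d (a(j := Suc (a j))) f)"
proof -
  let ?g = "\<lambda>a j. fps_in_var (d j) ((fps_deriv ^^ a j) (f j))"
  have "mfps_partial i (?g a j) * (\<Prod>l\<in>A - {j}. ?g a l) =
      (if d j = i then deriv_prod A d (a(j := Suc (a j))) f else 0)" if j: "j \<in> A" for j
    by (auto simp: mfps_partial_in_var deriv_prod_def prod.remove[OF assms j] intro!: prod.cong)
  thus ?thesis
    using assms unfolding deriv_prod_def[of A d a f]
    by (simp add: mfps_partial_prod sum.inter_filter)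
qed

lemma egf_nth_deriv: "fps_nth ((fps_deriv ^^ k) f) 0 = egf_nth f k"
  unfolding egf_nth_def by (simp add: fps_0th_higher_deriv)

lemma sum_PiE_insert:
  assumes "v \<notin> V"
  shows "(\<Sum>g\<in>PiE (insert v V) B. h g) = (\<Sum>j\<in>B v. \<Sum>g\<in>PiE V B. h (g(v := j)))"
proof -
  have "(\<Sum>g\<in>PiE (insert v V) B. h g) = (\<Sum>p\<in>B v \<times> PiE V B. h ((snd p)(v := fst p)))"
    unfolding PiE_insert_eq using assms
    by (subst sum.reindex[OF inj_combinator]) (simp_all add: split_beta)
  thus ?thesis by (simp add: sum.cartesian_product split_beta)
qed

section \<open>Coefficients of the products, by attaching leaves\<close>

definition leaf_type :: "('v \<Rightarrow> nat) \<Rightarrow> 'v set \<Rightarrow> nat \<Rightarrow>\<^sub>0 nat" where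
  "leaf_type \<kappa> V = (\<Sum>v\<in>V. Poly_Mapping.single (\<kappa> v) 1)"

lemma lookup_leaf_type:
  assumes "finite V"
  shows "Poly_Mapping.lookup (leaf_type \<kappa> V) i = card {v \<in> V. \<kappa> v = i}"
  using assms by (simp add: leaf_type_def lookup_sum lookup_single when_def flip: sum.inter_filter)

text \<open>Up to the factorials, the coefficient is an iterated partial derivative at \<open>0\<close>, with one
  derivative in direction \<open>\<kappa> v\<close> for each leaf \<open>v\<close>. Each of them hits one factor of the product,
  which becomes the parent \<open>g v\<close>.\<close>

lemma deriv_prod_nth:
  fixes f :: "'b \<Rightarrow> 'a::comm_ring_rat fps"
  assumes "finite V" "finite A" "finite I" "\<kappa> ` V \<subseteq> I"
  shows "(\<Prod>i\<in>I. fact (card {v \<in> V. \<kappa> v = i})) * mfps_nth (deriv_prod A d a f) (leaf_type \<kappa> V) =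
    (\<Sum>g\<in>PiE V (\<lambda>v. {j \<in> A. d j = \<kappa> v}). \<Prod>j\<in>A. egf_nth (f j) (a j + card {v \<in> V. g v = j}))"
  using assms(1,4)
\<comment> \<open>The orders \<open>a\<close> vary because each leaf raises one of them.\<close>
proof (induction V arbitrary: a)
  case empty
  show ?case
    by (simp add: leaf_type_def deriv_prod_def mfps_nth_prod_0 fps_in_var_def egf_nth_deriv)
next
  case (insert v V)
  let ?t = "leaf_type \<kappa> V" and ?B = "\<lambda>v. {j \<in> A. d j = \<kappa> v}"
  have card_insert: "card {u \<in> insert v V. h u = x} = (if h v = x then 1 else 0) + card {u \<in> V. h u = x}"
    for h :: "'c \<Rightarrow> 'd" and x
  proof -
    have "{u \<in> insert v V. h u = x} = (if h v = x then insert v {u \<in> V. h u = x} else {u \<in> V. h u = x})"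
      by auto
    thus ?thesis using insert.hyps by simp
  qed
  have v: "\<kappa> v \<in> I" using insert.prems by simp
  \<comment> \<open>The factorial at \<open>\<kappa> v\<close> grows by the new number of leaves
    there, which is the very factor in a coefficient of the partial derivative.\<close>
  have "(\<Prod>i\<in>I. fact (card {u \<in> insert v V. \<kappa> u = i})) =
      of_nat (Poly_Mapping.lookup ?t (\<kappa> v) + 1) * (\<Prod>i\<in>I. fact (card {u \<in> V. \<kappa> u = i}) :: 'a)"
    unfolding card_insert prod.remove[OF assms(3) v]
    by (simp add: lookup_leaf_type insert.hyps mult.assoc cong: prod.cong)
      (auto intro!: prod.cong)
  moreover have "leaf_type \<kappa> (insert v V) = ?t + Poly_Mapping.single (\<kappa> v) 1"
    using insert.hyps by (simp add: leaf_type_def add.commute)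
  ultimately have "(\<Prod>i\<in>I. fact (card {u \<in> insert v V. \<kappa> u = i})) *
        mfps_nth (deriv_prod A d a f) (leaf_type \<kappa> (insert v V)) =
      (\<Prod>i\<in>I. fact (card {u \<in> V. \<kappa> u = i})) * mfps_nth (mfps_partial (\<kappa> v) (deriv_prod A d a f)) ?t"
    by (simp only: mfps_nth_partial ac_simps)
  also have "\<dots> = (\<Sum>j\<in>?B v. (\<Prod>i\<in>I. fact (card {u \<in> V. \<kappa> u = i})) *
      mfps_nth (deriv_prod A d (a(j := Suc (a j))) f) ?t)"
    by (simp add: mfps_partial_deriv_prod assms(2) mfps_nth_sum sum_distrib_left)
  also have "\<dots> = (\<Sum>j\<in>?B v. \<Sum>g\<in>PiE V ?B.
      \<Prod>l\<in>A. egf_nth (f l) ((a(j := Suc (a j))) l + card {u \<in> V. g u = l}))"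
    using insert.IH insert.prems by simp
  also have "\<dots> = (\<Sum>j\<in>?B v. \<Sum>g\<in>PiE V ?B.
      \<Prod>l\<in>A. egf_nth (f l) (a l + card {u \<in> insert v V. (g(v := j)) u = l}))"
  proof (intro sum.cong prod.cong refl)
    fix j l :: 'b and g :: "'c \<Rightarrow> 'b"
    have "{u \<in> V. (g(v := j)) u = l} = {u \<in> V. g u = l}"
      using insert.hyps by auto
    thus "egf_nth (f l) ((a(j := Suc (a j))) l + card {u \<in> V. g u = l}) =
        egf_nth (f l) (a l + card {u \<in> insert v V. (g(v := j)) u = l})"
      unfolding card_insert by auto
  qed
  \<comment> \<open>The factor \<open>j\<close> hit by the derivative becomes the value of
    \<open>g\<close> at \<open>v\<close>.\<close>
  also have "\<dots> = (\<Sum>g\<in>PiE (insert v V) ?B.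
      \<Prod>l\<in>A. egf_nth (f l) (a l + card {u \<in> insert v V. g u = l}))"
    using insert.hyps by (subst sum_PiE_insert) simp_all
  finally show ?case .
qed


section \<open>Increasing trees as parent functions\<close>

text \<open>A forest on \<open>{1..n}\<close> becomes a tree by adding the root \<open>0\<close>, so that depths are heights
  increased by one.\<close>

definition inc_parents :: "nat \<Rightarrow> (nat \<Rightarrow> nat) set" where
  "inc_parents n = PiE {1..n} (\<lambda>j. {..<j})"

text \<open>The guard makes the recursion terminate for every \<open>p\<close>. On
  \<open>inc_parents n\<close> it holds at all of \<open>{1..n}\<close>, and it always fails at 0,
  the root.\<close>

function depth :: "(nat \<Rightarrow> nat) \<Rightarrow> nat \<Rightarrow> nat" where
  "depth p j = (if p j < j then Suc (depth p (p j)) else 0)"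
  by auto
termination by (relation "measure snd") auto

declare depth.simps [simp del]

definition child_count :: "nat \<Rightarrow> (nat \<Rightarrow> nat) \<Rightarrow> nat \<Rightarrow> nat" where
  "child_count n p j = card {i \<in> {1..n}. p i = j}"

lemma inc_parentsD: "p \<in> inc_parents n \<Longrightarrow> j \<in> {1..n} \<Longrightarrow> p j < j"
  by (auto simp: inc_parents_def)

lemma finite_inc_parents: "finite (inc_parents n)"
  by (simp add: inc_parents_def finite_PiE)

lemma depth_0 [simp]: "depth p 0 = 0"
  by (simp add: depth.simps)

lemma depth_parent: "p \<in> inc_parents n \<Longrightarrow> j \<in> {1..n} \<Longrightarrow> depth p j = Suc (depth p (p j))"
  using inc_parentsD[of p n j] by (subst depth.simps) simp

text \<open>Each step to a parent lowers the label by at least one. This keeps the depths of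
  \<open>{..n}\<close> within the summation range of
  \<open>diff_op \<phi> q (Suc n)\<close>.\<close>

lemma depth_le: "depth p j \<le> j"
proof (induction j rule: less_induct)
  case (less j)
  show ?case
    using less[of "p j"] by (cases "p j < j") (simp_all add: depth.simps[of p j])
qed

lemma depth_fun_upd: "j \<le> n \<Longrightarrow> depth (p(Suc n := l)) j = depth p j"
proof (induction j rule: less_induct)
  case (less j)
  thus ?case
    by (simp add: depth.simps[of _ j])
qed

section \<open>Growing a tree by its largest vertex\<close>

lemma sum_inc_parents_Suc:
  "(\<Sum>p\<in>inc_parents (Suc n). h p) = (\<Sum>p\<in>inc_parents n. \<Sum>j\<le>n. h (p(Suc n := j)))"
proof -
  have "{1..Suc n} = insert (Suc n) {1..n}" by auto
  hence "(\<Sum>p\<in>inc_parents (Suc n). h p) = (\<Sum>j<Suc n. \<Sum>p\<in>inc_parents n. h (p(Suc n := j)))"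
    unfolding inc_parents_def by (simp only:) (subst sum_PiE_insert, simp_all)
  also have "\<dots> = (\<Sum>p\<in>inc_parents n. \<Sum>j\<le>n. h (p(Suc n := j)))"
    by (subst sum.swap) (simp add: lessThan_Suc_atMost)
  finally show ?thesis .
qed

lemma child_count_fun_upd:
  assumes "j \<le> n"
  shows "child_count (Suc n) (p(Suc n := j)) l = (if l = j then 1 else 0) + child_count n p l"
proof -
  have "{i \<in> {1..Suc n}. (p(Suc n := j)) i = l} =
      (if l = j then insert (Suc n) {i \<in> {1..n}. p i = l} else {i \<in> {1..n}. p i = l})"
    by auto
  thus ?thesis by (simp add: child_count_def)
qed

lemma child_count_eq_0:
  assumes "p \<in> inc_parents n" "n < l"
  shows "child_count n p l = 0"
  using assms inc_parentsD[OF assms(1)] by (fastforce simp: child_count_def)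

text \<open>Since depth exceeds height by one, the depth of the parent of \<open>j\<close> is the
  height of \<open>j\<close> in the forest left after deleting 0.\<close>

definition tree_weight :: "(nat \<Rightarrow> 'a::comm_ring_1) \<Rightarrow> nat \<Rightarrow> (nat \<Rightarrow> nat) \<Rightarrow> 'a" where
  "tree_weight q n p = (\<Prod>j\<in>{1..n}. q (depth p (p j)))"

lemma tree_weight_fun_upd:
  assumes "p \<in> inc_parents n" "j \<le> n"
  shows "tree_weight q (Suc n) (p(Suc n := j)) = q (depth p j) * tree_weight q n p"
proof -
  have "(\<Prod>i\<in>{1..n}. q (depth (p(Suc n := j)) ((p(Suc n := j)) i))) = tree_weight q n p"
    unfolding tree_weight_def
  proof (intro prod.cong refl)
    fix i assume i: "i \<in> {1..n}"
    have "p i \<le> n" using inc_parentsD[OF assms(1) i] i by simp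
    thus "q (depth (p(Suc n := j)) ((p(Suc n := j)) i)) = q (depth p (p i))"
      using i by (simp add: depth_fun_upd)
  qed
  thus ?thesis
    using assms(2) by (simp add: tree_weight_def depth_fun_upd mult.commute)
qed

text \<open>By the Leibniz rule, \<open>diff_op \<phi> q (Suc n)\<close> attaches the new vertex \<open>Suc n\<close> to every vertex
  \<open>j \<le> n\<close>.\<close>

lemma Delta_op_eq_sum_trees:
  fixes \<phi> F :: "'a::comm_ring_1 fps"
  defines "f \<equiv> (\<lambda>_. \<phi>)(0 := F)"
  shows "Delta_op \<phi> q n (fps_in_var 0 F) = (\<Sum>p\<in>inc_parents n.
    mfps_const (tree_weight q n p) * deriv_prod {..n} (depth p) (child_count n p) f)"
proof (induction n)
  case 0
  have "mfps_const 1 = (1 :: 'a mfps)"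
    by (rule mfps_eqI) (simp add: mfps_const_def)
  thus ?case
    by (simp add: inc_parents_def tree_weight_def deriv_prod_def child_count_def f_def)
next
  case (Suc n)
  let ?P = "\<lambda>p a. deriv_prod {..n} (depth p) a f"
  let ?c = "\<lambda>p. child_count n p"
  let ?w = "\<lambda>p. mfps_const (tree_weight q n p)"
  have "Delta_op \<phi> q (Suc n) (fps_in_var 0 F) =
      (\<Sum>k<Suc n. fps_in_var (k + 1) \<phi> * mfps_const (q k) *
        (\<Sum>p\<in>inc_parents n. ?w p * (\<Sum>j | j \<in> {..n} \<and> depth p j = k. ?P p ((?c p)(j := Suc (?c p j))))))"
    by (simp only: Delta_op.simps Suc diff_op_def mfps_partial_sum mfps_partial_const_mult
        mfps_partial_deriv_prod finite_atMost)
  also have "\<dots> = (\<Sum>k<Suc n. \<Sum>p\<in>inc_parents n. \<Sum>j | j \<in> {..n} \<and> depth p j = k.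
        fps_in_var (depth p j + 1) \<phi> * mfps_const (q (depth p j)) * ?w p * ?P p ((?c p)(j := Suc (?c p j))))"
    by (simp add: sum_distrib_left mult.assoc)
  also have "\<dots> = (\<Sum>p\<in>inc_parents n. \<Sum>k<Suc n. \<Sum>j | j \<in> {..n} \<and> depth p j = k.
        fps_in_var (depth p j + 1) \<phi> * mfps_const (q (depth p j)) * ?w p * ?P p ((?c p)(j := Suc (?c p j))))"
    by (rule sum.swap)
  \<comment> \<open>Every vertex \<open>j\<close> occurs for exactly one \<open>k\<close>, namely
    its depth.\<close>
  also have "\<dots> = (\<Sum>p\<in>inc_parents n. \<Sum>j\<in>{..n}.
        fps_in_var (depth p j + 1) \<phi> * mfps_const (q (depth p j)) * ?w p * ?P p ((?c p)(j := Suc (?c p j))))"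
    by (intro sum.cong sum.group refl) (auto simp: less_Suc_eq_le intro: order.trans[OF depth_le])
  also have "\<dots> = (\<Sum>p\<in>inc_parents n. \<Sum>j\<le>n. mfps_const (tree_weight q (Suc n) (p(Suc n := j))) *
      deriv_prod {..Suc n} (depth (p(Suc n := j))) (child_count (Suc n) (p(Suc n := j))) f)"
  proof (intro sum.cong refl)
    fix p j assume p: "p \<in> inc_parents n" and j: "j \<in> {..n}"
    have "deriv_prod {..n} (depth (p(Suc n := j))) (child_count (Suc n) (p(Suc n := j))) f =
        ?P p ((?c p)(j := Suc (?c p j)))"
      using j by (intro deriv_prod_cong) (auto simp: depth_fun_upd child_count_fun_upd)
    \<comment> \<open>The new vertex is one level below \<open>j\<close> and childless, so its
      factor is the underived \<phi> that the operator multiplies by.\<close>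
    moreover have "depth (p(Suc n := j)) (Suc n) = Suc (depth p j)"
      using j by (subst depth.simps) (simp add: depth_fun_upd)
    moreover have "child_count (Suc n) (p(Suc n := j)) (Suc n) = 0"
      using j child_count_eq_0[OF p] by (simp add: child_count_fun_upd)
    ultimately have "deriv_prod {..Suc n} (depth (p(Suc n := j))) (child_count (Suc n) (p(Suc n := j))) f =
        fps_in_var (depth p j + 1) \<phi> * ?P p ((?c p)(j := Suc (?c p j)))"
      by (simp add: deriv_prod_def atMost_Suc f_def)
    thus "fps_in_var (depth p j + 1) \<phi> * mfps_const (q (depth p j)) * ?w p * ?P p ((?c p)(j := Suc (?c p j))) =
        mfps_const (tree_weight q (Suc n) (p(Suc n := j))) *
        deriv_prod {..Suc n} (depth (p(Suc n := j))) (child_count (Suc n) (p(Suc n := j))) f"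
      using p j by (simp add: tree_weight_fun_upd mfps_const_mult ac_simps)
  qed
  finally show ?case
    unfolding sum_inc_parents_Suc .
qed


section \<open>Edge sets and parent functions\<close>

lemma height_root: "r \<notin> Range E \<Longrightarrow> height E r = 0"
  unfolding height_def by (rule Least_eq_0) auto

text \<open>As \<open>u\<close> is the only parent of \<open>v\<close>, paths from a root to
  \<open>v\<close> are those to \<open>u\<close> with one more edge. The last hypothesis provides
  such a path; without any, both heights would be the same unspecified number.\<close>

lemma height_child:
  assumes "single_valued (E\<inverse>)" "(u, v) \<in> E" "\<exists>d r. r \<notin> Range E \<and> (r, u) \<in> E ^^ d"
  shows "height E v = Suc (height E u)"
proof -
  let ?P = "\<lambda>v d. \<exists>r. r \<notin> Range E \<and> (r, v) \<in> E ^^ d"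
  have eq: "?P v (Suc d) \<longleftrightarrow> ?P u d" for d
    using assms(1,2) by (auto dest: single_valuedD)
  obtain d where "?P v (Suc d)" using assms(3) unfolding eq by blast
  moreover have "\<not> ?P v 0" using assms(2) by auto
  ultimately have "(LEAST d. ?P v d) = Suc (LEAST d. ?P v (Suc d))"
    by (rule Least_Suc)
  thus ?thesis by (simp only: eq height_def)
qed

text \<open>Vertex 0 is deleted together with its edges to internal vertices, so its children become
  the roots.\<close>

definition forest_edges ::
    "nat \<Rightarrow> 'v set \<Rightarrow> (nat \<Rightarrow> nat) \<Rightarrow> ('v \<Rightarrow> nat) \<Rightarrow> ((nat + 'v) \<times> (nat + 'v)) set" where
  "forest_edges n V p g = {(Inl (p j), Inl j) | j. j \<in> {1..n} \<and> p j \<noteq> 0} \<union> {(Inl (g v), Inr v) | v. v \<in> V}"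

lemma forest_edges_iff [simp]:
  "(Inl i, Inl j) \<in> forest_edges n V p g \<longleftrightarrow> j \<in> {1..n} \<and> p j \<noteq> 0 \<and> p j = i"
  "(Inl i, Inr v) \<in> forest_edges n V p g \<longleftrightarrow> v \<in> V \<and> g v = i"
  "(Inr v, y) \<notin> forest_edges n V p g"
  by (auto simp: forest_edges_def)

lemma single_valued_forest_edges: "single_valued ((forest_edges n V p g)\<inverse>)"
  by (rule single_valuedI) (auto simp: forest_edges_def)

lemma Range_forest_edges:
  "Range (forest_edges n V p g) = Inl ` {j \<in> {1..n}. p j \<noteq> 0} \<union> Inr ` V"
  by (auto simp: forest_edges_def Range_iff)

text \<open>The second conjunct strengthens the induction: it supplies the path from a root that
  \<open>height_child\<close> requires.\<close>

lemma height_forest_edges_internal: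
  assumes p: "p \<in> inc_parents n" and j: "j \<in> {1..n}"
  shows "depth p j = Suc (height (forest_edges n V p g) (Inl j)) \<and>
    (\<exists>d r. r \<notin> Range (forest_edges n V p g) \<and> (r, Inl j) \<in> forest_edges n V p g ^^ d)"
  using j
proof (induction j rule: less_induct)
  case (less j)
  let ?E = "forest_edges n V p g"
  show ?case
  proof (cases "p j = 0")
    case True
    hence root: "(Inl j :: nat + 'a) \<notin> Range ?E"
      by (auto simp: Range_forest_edges)
    moreover have "(Inl j, Inl j) \<in> ?E ^^ 0" by simp
    ultimately have "\<exists>d r. r \<notin> Range ?E \<and> (r, Inl j) \<in> ?E ^^ d" by blast
    thus ?thesis
      using root True depth_parent[OF p less.prems] by (simp add: height_root del: Range_iff)
  next
    case False
    hence pj: "p j < j" "p j \<in> {1..n}"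
      using inc_parentsD[OF p less.prems] less.prems by auto
    note IH = less.IH[OF pj]
    have edge: "(Inl (p j), Inl j) \<in> ?E" using False less.prems by simp
    obtain d r where "r \<notin> Range ?E" "(r, Inl (p j)) \<in> ?E ^^ d" using IH by blast
    hence "r \<notin> Range ?E \<and> (r, Inl j) \<in> ?E ^^ Suc d" using edge by auto
    thus ?thesis
      using height_child[OF single_valued_forest_edges edge] IH depth_parent[OF p less.prems]
      by metis
  qed
qed

text \<open>A leaf lies one below its parent, and depth exceeds height by one; the shifts cancel.
  Hence prescribing the height of a leaf selects the variable of its parent's factor in
  \<open>deriv_prod\<close>.\<close>

lemma height_forest_edges_leaf:
  assumes p: "p \<in> inc_parents n" and v: "v \<in> V" "g v \<in> {1..n}"
  shows "height (forest_edges n V p g) (Inr v) = depth p (g v)"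
  using height_child[OF single_valued_forest_edges, of "Inl (g v)" "Inr v"]
    height_forest_edges_internal[OF p v(2), of V g] v(1) by auto

lemma card_children_forest_edges:
  assumes "finite V" "j \<noteq> 0"
  shows "card (children (forest_edges n V p g) (Inl j)) = child_count n p j + card {v \<in> V. g v = j}"
proof -
  have "children (forest_edges n V p g) (Inl j) = {i \<in> {1..n}. p i = j} <+> {v \<in> V. g v = j}"
    using assms(2) by (auto simp: children_def forest_edges_def)
  moreover have "finite {i \<in> {1..n}. p i = j}" "finite {v \<in> V. g v = j}"
    using assms(1) by simp_all
  ultimately show ?thesis
    by (simp only: card_Plus child_count_def)
qed

lemma forest_roots_forest_edges:
  "forest_roots (forest_vertices n V) (forest_edges n V p g) = Inl ` {j \<in> {1..n}. p j = 0}"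
  by (auto simp: forest_roots_def forest_vertices_def Range_forest_edges image_iff)

section \<open>The bijection between forests and pairs of parent functions\<close>

definition leaf_parents ::
    "nat \<Rightarrow> 'v set \<Rightarrow> ('v \<Rightarrow> nat) \<Rightarrow> (nat \<Rightarrow> nat) \<Rightarrow> ('v \<Rightarrow> nat) set" where
  "leaf_parents n V \<kappa> p = PiE V (\<lambda>v. {j \<in> {1..n}. depth p j = \<kappa> v})"

lemma forest_edges_increasing:
  assumes p: "p \<in> inc_parents n" and g: "g \<in> leaf_parents n V \<kappa> p"
  shows "forest_edges n V p g \<in> increasing_forests n (child_count n p 0) V \<kappa>"
proof -
  let ?E = "forest_edges n V p g"
  \<comment> \<open>Ranking all leaves above the internal labels makes every edge increase the rank,
    which gives both acyclicity and increasing labels.\<close>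
  let ?rank = "case_sum id (\<lambda>_. Suc n) :: nat + 'a \<Rightarrow> nat"
  have g': "g v \<in> {1..n}" "depth p (g v) = \<kappa> v" if "v \<in> V" for v
    using g that by (auto simp: leaf_parents_def)
  have rank: "?rank x < ?rank y" if "(x, y) \<in> ?E\<^sup>+" for x y
    using that
  proof (induction rule: trancl_induct)
    case (base y)
    thus ?case using inc_parentsD[OF p] g' by (fastforce simp: forest_edges_def)
  next
    case (step y z)
    hence "?rank y < ?rank z"
      using inc_parentsD[OF p] g' by (fastforce simp: forest_edges_def)
    thus ?case using step.IH by simp
  qed
  have "acyclic ?E"
    using rank by (auto simp: acyclic_def)
  moreover have "?E \<subseteq> forest_vertices n V \<times> forest_vertices n V"
    using inc_parentsD[OF p] g' by (fastforce simp: forest_edges_def forest_vertices_def)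
  ultimately have "rooted_forest (forest_vertices n V) ?E"
    by (simp add: rooted_forest_def single_valued_forest_edges)
  moreover have "i < j" if "(Inl i, Inl j) \<in> ?E\<^sup>+" for i j
    using rank[OF that] by simp
  moreover have "children ?E (Inr v) = {}" for v
    by (auto simp: children_def)
  moreover have "height ?E (Inr v) = \<kappa> v" if "v \<in> V" for v
    using height_forest_edges_leaf[OF p that, of g] g'[OF that] by simp
  ultimately show ?thesis
    by (simp add: increasing_forests_def forest_roots_forest_edges card_image child_count_def
        image_subset_iff)
qed

lemma increasing_forest_is_forest_edges:
  assumes E: "E \<in> increasing_forests n k V \<kappa>"
  obtains p g where "p \<in> inc_parents n" "child_count n p 0 = k" "g \<in> leaf_parents n V \<kappa> p"
    "E = forest_edges n V p g"
proof -
  let ?X = "forest_vertices n V"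
  have EX: "E \<subseteq> ?X \<times> ?X" and sv: "single_valued (E\<inverse>)"
    and inc: "\<And>i j. (Inl i, Inl j) \<in> E\<^sup>+ \<Longrightarrow> i < j"
    and roots: "forest_roots ?X E \<subseteq> range Inl" "card (forest_roots ?X E) = k"
    and leaf: "\<And>v. v \<in> V \<Longrightarrow> children E (Inr v) = {}"
    and ht: "\<And>v. v \<in> V \<Longrightarrow> height E (Inr v) = \<kappa> v"
    using E by (auto simp: increasing_forests_def rooted_forest_def)
  have parent: "\<exists>i\<in>{1..n}. x = Inl i" if "(x, y) \<in> E" for x y
    using that EX leaf by (cases x) (fastforce simp: forest_vertices_def children_def)+
  \<comment> \<open>Roots get parent 0; the value \<open>undefined\<close> elsewhere is what
    membership in \<open>PiE\<close> demands.\<close>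
  define p where "p = (\<lambda>j. if j \<in> {1..n} then
      if Inl j \<in> Range E then (THE i. (Inl i, Inl j) \<in> E) else 0 else undefined)"
  define g where "g = (\<lambda>v. if v \<in> V then (THE i. (Inl i, Inr v) \<in> E) else undefined)"
  have the: "(THE i. (Inl i, y) \<in> E) = i" if "(Inl i, y) \<in> E" for i y
    using that sv by (auto intro!: the_equality dest: single_valuedD)
  have p: "j \<in> {1..n} \<and> p j = i" if "(Inl i, Inl j) \<in> E" for i j
    using that the[OF that] EX by (auto simp: p_def forest_vertices_def)
  have p0: "p j = 0" if "j \<in> {1..n}" "Inl j \<notin> Range E" for j
    using that unfolding p_def by (simp del: Range_iff)
  have p': "p j < j \<and> (p j \<noteq> 0 \<longrightarrow> (Inl (p j), Inl j) \<in> E)" if j: "j \<in> {1..n}" for j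
  proof (cases "Inl j \<in> Range E")
    case True
    then obtain x where x: "(x, Inl j) \<in> E" by blast
    then obtain i where "x = Inl i" using parent by blast
    thus ?thesis using x p inc[OF r_into_trancl] by auto
  qed (use p0 j in auto)
  have g: "v \<in> V \<and> g v = i" if "(Inl i, Inr v) \<in> E" for i v
    using that the[OF that] EX by (auto simp: g_def forest_vertices_def)
  have g': "(Inl (g v), Inr v) \<in> E \<and> g v \<in> {1..n}" if v: "v \<in> V" for v
  proof -
    \<comment> \<open>All roots are internal, so every leaf has a parent.\<close>
    have "Inr v \<notin> forest_roots ?X E" using roots(1) by auto
    hence "Inr v \<in> Range E" using v by (simp add: forest_roots_def forest_vertices_def)
    then obtain x where x: "(x, Inr v) \<in> E" by blast
    then obtain i where "x = Inl i" "i \<in> {1..n}" using parent by blast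
    thus ?thesis using x g by auto
  qed
  \<comment> \<open>Genuine parents have labels from 1 on, so the value 0 marks roots
    unambiguously.\<close>
  have pn0: "p j \<noteq> 0" if "(Inl i, Inl j) \<in> E" for i j
    using p[OF that] parent[OF that] by auto
  have eq: "E = forest_edges n V p g"
  proof (rule set_eqI)
    fix e :: "(nat + 'a) \<times> (nat + 'a)"
    obtain x y where e: "e = (x, y)" by fastforce
    show "e \<in> E \<longleftrightarrow> e \<in> forest_edges n V p g"
    proof (cases x)
      case (Inl i)
      show ?thesis
        using p p' g g' pn0 by (cases y) (auto simp: e Inl)
    next
      case (Inr v)
      thus ?thesis using parent[of x y] by (auto simp: e)
    qed
  qed
  have P: "p \<in> inc_parents n"
    using p' unfolding inc_parents_def by (auto simp: p_def)
  moreover have "g \<in> leaf_parents n V \<kappa> p"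
    unfolding leaf_parents_def
  proof (rule PiE_I)
    fix v assume v: "v \<in> V"
    show "g v \<in> {j \<in> {1..n}. depth p j = \<kappa> v}"
      using height_forest_edges_leaf[OF P v] g'[OF v] ht[OF v] eq by auto
  qed (simp add: g_def)
  moreover have "child_count n p 0 = k"
    using roots(2) by (simp add: eq forest_roots_forest_edges card_image child_count_def)
  ultimately show ?thesis using eq that by blast
qed

lemma bij_betw_forest_edges:
  "bij_betw (\<lambda>(p, g). forest_edges n V p g)
     (Sigma {p \<in> inc_parents n. child_count n p 0 = k} (leaf_parents n V \<kappa>))
     (increasing_forests n k V \<kappa>)"
  unfolding bij_betw_def
proof (intro conjI equalityI subsetI)
  show "inj_on (\<lambda>(p, g). forest_edges n V p g)
     (Sigma {p \<in> inc_parents n. child_count n p 0 = k} (leaf_parents n V \<kappa>))"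
  proof (rule inj_onI, clarify)
    fix p g p' g'
    assume p: "p \<in> inc_parents n" "p' \<in> inc_parents n"
      and g: "g \<in> leaf_parents n V \<kappa> p" "g' \<in> leaf_parents n V \<kappa> p'"
      and eq: "forest_edges n V p g = forest_edges n V p' g'"
    have [simp]: "p' = p"
    proof (rule PiE_ext[OF p(2,1)[unfolded inc_parents_def]])
      fix j assume "j \<in> {1..n}"
      thus "p' j = p j"
        using forest_edges_iff(1)[of _ j n V p g] forest_edges_iff(1)[of _ j n V p' g'] eq
        by metis
    qed
    have "g = g'"
    proof (rule PiE_ext[OF g[unfolded leaf_parents_def \<open>p' = p\<close>]])
      fix v assume "v \<in> V"
      thus "g v = g' v"
        using forest_edges_iff(2)[of _ v n V p g] forest_edges_iff(2)[of _ v n V p' g'] eq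
        by metis
    qed
    thus "p = p' \<and> g = g'" by simp
  qed
next
  fix E assume "E \<in> (\<lambda>(p, g). forest_edges n V p g) `
     (Sigma {p \<in> inc_parents n. child_count n p 0 = k} (leaf_parents n V \<kappa>))"
  thus "E \<in> increasing_forests n k V \<kappa>"
    using forest_edges_increasing by auto
next
  fix E assume "E \<in> increasing_forests n k V \<kappa>"
  then obtain p g where "p \<in> inc_parents n" "child_count n p 0 = k" "g \<in> leaf_parents n V \<kappa> p"
    "E = forest_edges n V p g"
    by (rule increasing_forest_is_forest_edges)
  thus "E \<in> (\<lambda>(p, g). forest_edges n V p g) `
     (Sigma {p \<in> inc_parents n. child_count n p 0 = k} (leaf_parents n V \<kappa>))"
    by force
qed

section \<open>Forest sums and forest series as sums over trees\<close>

lemma forest_weight_forest_edges: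
  assumes "finite V" "p \<in> inc_parents n"
  shows "forest_weight \<phi> q n (forest_edges n V p g) =
    tree_weight q n p * (\<Prod>j\<in>{1..n}. egf_nth \<phi> (child_count n p j + card {v \<in> V. g v = j}))"
  unfolding forest_weight_def tree_weight_def prod.distrib[symmetric]
proof (intro prod.cong refl)
  fix j assume j: "j \<in> {1..n}"
  have "height (forest_edges n V p g) (Inl j) = depth p (p j)"
    using height_forest_edges_internal[OF assms(2) j, of V g] depth_parent[OF assms(2) j] by simp
  thus "egf_nth \<phi> (card (children (forest_edges n V p g) (Inl j))) * q (height (forest_edges n V p g) (Inl j)) =
      q (depth p (p j)) * egf_nth \<phi> (child_count n p j + card {v \<in> V. g v = j})"
    using j assms(1) by (simp add: card_children_forest_edges mult.commute)
qed

lemma forest_sum_eq: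
  fixes \<phi> :: "'a::comm_ring_rat fps"
  assumes "finite V"
  shows "forest_sum \<phi> q n k V \<kappa> = (\<Sum>p | p \<in> inc_parents n \<and> child_count n p 0 = k.
    tree_weight q n p * (\<Sum>g\<in>leaf_parents n V \<kappa> p.
      \<Prod>j\<in>{1..n}. egf_nth \<phi> (child_count n p j + card {v \<in> V. g v = j})))"
proof -
  have "finite (leaf_parents n V \<kappa> p)" for p
    using assms by (simp add: leaf_parents_def finite_PiE)
  thus ?thesis
    unfolding forest_sum_def sum.reindex_bij_betw[OF bij_betw_forest_edges, symmetric]
    using assms
    by (simp add: finite_inc_parents sum.Sigma[symmetric] sum_distrib_left forest_weight_forest_edges
        split_beta cong: sum.cong)
      (auto simp: forest_weight_forest_edges sum.Sigma finite_inc_parents intro!: sum.cong)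
qed

text \<open>The inner sum over leaf parents in \<open>forest_sum_eq\<close> is the one that
  \<open>deriv_prod_nth\<close> yields for the vertices \<open>{1..n}\<close>, so coefficients agree
  up to the same factorials.\<close>

lemma forest_series_eq_sum_trees:
  fixes \<phi> :: "'a::comm_ring_rat fps"
  shows "forest_series \<phi> q n k = (\<Sum>p | p \<in> inc_parents n \<and> child_count n p 0 = k.
    mfps_const (tree_weight q n p) * deriv_prod {1..n} (depth p) (child_count n p) (\<lambda>_. \<phi>))"
    (is "_ = ?G")
proof (rule mfps_eqI)
  fix m
  show "mfps_nth (forest_series \<phi> q n k) m = mfps_nth ?G m"
  proof (cases "Poly_Mapping.keys m \<subseteq> {1..n}")
    case False
    then obtain i where i: "i \<in> Poly_Mapping.keys m" "i \<notin> {1..n}" by blast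
    \<comment> \<open>No factor of \<open>?G\<close> involves a variable outside
      \<open>{1..n}\<close>, so its derivative in direction \<open>i\<close> vanishes.\<close>
    have "depth p j \<in> {1..n}" if "p \<in> inc_parents n" "j \<in> {1..n}" for p j
      using that depth_parent[OF that] depth_le[of p j] by auto
    hence "{j. j \<in> {1..n} \<and> depth p j = i} = {}" if "p \<in> inc_parents n" for p
      using i that by blast
    hence "mfps_partial i ?G = 0"
      by (simp add: mfps_partial_sum mfps_partial_const_mult mfps_partial_deriv_prod del: Collect_empty_eq)
    thus ?thesis
      using False i by (simp add: forest_series_def mfps_nth_eq_0_if_partial_eq_0)
  next
    case True
    let ?V = "SIGMA i:{1..n}. {..<Poly_Mapping.lookup m i}"
    have card: "card {v \<in> ?V. fst v = i} = Poly_Mapping.lookup m i" if "i \<in> {1..n}" for i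
    proof -
      have "{v \<in> ?V. fst v = i} = {i} \<times> {..<Poly_Mapping.lookup m i}" using that by auto
      thus ?thesis by simp
    qed
    have type: "leaf_type fst ?V = m"
    proof (rule poly_mapping_eqI)
      fix i
      show "Poly_Mapping.lookup (leaf_type fst ?V) i = Poly_Mapping.lookup m i"
      proof (cases "i \<in> {1..n}")
        case False
        hence "Poly_Mapping.lookup m i = 0" using True by (auto simp: in_keys_iff)
        moreover have "{v \<in> ?V. fst v = i} = {}" using False by auto
        ultimately show ?thesis by (simp add: lookup_leaf_type del: Collect_empty_eq)
      qed (use card in \<open>simp add: lookup_leaf_type\<close>)
    qed
    let ?f = "\<Prod>i\<in>{1..n}. fact (Poly_Mapping.lookup m i) :: 'a"
    have "?f * mfps_nth (deriv_prod {1..n} (depth p) (child_count n p) (\<lambda>_. \<phi>)) m =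
        (\<Sum>g\<in>leaf_parents n ?V fst p.
          \<Prod>j\<in>{1..n}. egf_nth \<phi> (child_count n p j + card {v \<in> ?V. g v = j}))" for p
    proof -
      have "?f = (\<Prod>i\<in>{1..n}. fact (card {v \<in> ?V. fst v = i}))"
        by (rule prod.cong) (simp_all only: card)
      moreover have "finite ?V" "fst ` ?V \<subseteq> {1..n}" by auto
      ultimately show ?thesis
        using deriv_prod_nth[of ?V "{1..n}" "{1..n}" fst "depth p" "child_count n p" "\<lambda>_. \<phi>"]
        by (simp only: type leaf_parents_def finite_atLeastAtMost)
    qed
    hence "?f * mfps_nth ?G m = forest_sum \<phi> q n k ?V fst"
      by (simp add: forest_sum_eq mfps_nth_sum mfps_nth_const_mult sum_distrib_left mult.left_commute)
    moreover have "?f * mfps_nth (forest_series \<phi> q n k) m = forest_sum \<phi> q n k ?V fst"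
      by (rule forest_series_nth) (use True card in auto)
    ultimately have "?f * (mfps_nth (forest_series \<phi> q n k) m - mfps_nth ?G m) = 0"
      by (simp add: right_diff_distrib)
    \<comment> \<open>Written as a positive integer, the factorials can be cancelled.\<close>
    hence "of_nat (\<Prod>i\<in>{1..n}. fact (Poly_Mapping.lookup m i)) *
        (mfps_nth (forest_series \<phi> q n k) m - mfps_nth ?G m) = 0"
      by simp
    hence "mfps_nth (forest_series \<phi> q n k) m - mfps_nth ?G m = 0"
      by (rule of_nat_mult_eq_0_rat) simp
    thus ?thesis by simp
  qed
qed

section \<open>Grouping trees by the number of children of vertex 0\<close>

theorem theorem4:
  fixes \<phi> F :: "'a::comm_ring_rat fps" and q :: "nat \<Rightarrow> 'a" and n :: nat
  assumes "n \<ge> 1"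
  shows "Delta_op \<phi> q n (fps_in_var 0 F) =
    (\<Sum>k=1..n. fps_in_var 0 ((fps_deriv ^^ k) F) * forest_series \<phi> q n k)"
proof -
  let ?f = "(\<lambda>_. \<phi>)(0 := F)"
  let ?G = "\<lambda>p. mfps_const (tree_weight q n p) * deriv_prod {1..n} (depth p) (child_count n p) (\<lambda>_. \<phi>)"
  \<comment> \<open>Vertex 0 has depth 0 and carries \<open>F\<close>; its factor is the derivative
    of \<open>F\<close> at variable 0 whose order is the number of trees.\<close>
  have split: "mfps_const (tree_weight q n p) * deriv_prod {..n} (depth p) (child_count n p) ?f =
      fps_in_var 0 ((fps_deriv ^^ child_count n p 0) F) * ?G p" for p
  proof -
    have "{..n} = insert 0 {1..n}" by auto
    moreover have "deriv_prod {1..n} (depth p) (child_count n p) ?f =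
        deriv_prod {1..n} (depth p) (child_count n p) (\<lambda>_. \<phi>)"
      by (rule deriv_prod_cong) auto
    ultimately show ?thesis
      by (simp add: deriv_prod_def mult.left_commute)
  qed
  have "child_count n p 0 \<in> {1..n}" if p: "p \<in> inc_parents n" for p
  proof -
    \<comment> \<open>Vertex 1 exists because \<open>n \<ge> 1\<close>, and its parent can only be
      0.\<close>
    have "1 \<in> {i \<in> {1..n}. p i = 0}" using assms inc_parentsD[OF p, of 1] by simp
    hence "child_count n p 0 \<noteq> 0" by (auto simp: child_count_def)
    moreover have "child_count n p 0 \<le> card {1..n}"
      unfolding child_count_def by (rule card_mono) auto
    ultimately show ?thesis by simp
  qed
  hence "Delta_op \<phi> q n (fps_in_var 0 F) = (\<Sum>k=1..n. \<Sum>p | p \<in> inc_parents n \<and> child_count n p 0 = k.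
      fps_in_var 0 ((fps_deriv ^^ child_count n p 0) F) * ?G p)"
    unfolding Delta_op_eq_sum_trees split
    by (intro sum.group[symmetric]) (auto simp: finite_inc_parents)
  also have "\<dots> = (\<Sum>k=1..n. fps_in_var 0 ((fps_deriv ^^ k) F) * forest_series \<phi> q n k)"
    by (simp add: forest_series_eq_sum_trees sum_distrib_left)
  finally show ?thesis .
qed

end
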